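(* Assume: (existence) $\mathcal Z$ is compact, the minima in the lexicographic cascade are attained, the set of minimizers of $J$ on $\mathcal F_L$ is non-empty, and for every $w\in\mathbb R_{++}^L$ the weighted-sum problem has a minimizer; (uniqueness) the lexicographic optimum $z^\star_{\mathrm{lex}}$ is unique, with uniquely determined image $p^\star$; (convexity) $\mathcal Z$ is convex, every $g_{i,j}$ is convex, and $J$ is convex. Then for every $w\in\mathbb R_{++}^L$, $$z^\star_{\mathrm{lex}}\in\operatorname*{arg\,min}_{z\in\mathcal Z}\Bigl[J(z)+\sum_{i=1}^L w_iV_i(z)\Bigr]\iff w\in\Omega(p^\star).$$ If, in addition, the weighted-sum minimizer is unique (for instance, when $J+\sum_i w_iV_i$ is strictly convex on $\mathcal Z$), then $z^\star_{\mathrm{ws}}(w)=z^\star_{\mathrm{lex}}$ for every $w\in\Omega(p^\star)$.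
   Context: Let $L\ge1$, $m_1,\dots,m_L\ge1$ and $d\ge 1$ be integers. $\mathcal Z\subset\mathbb R^d$ is the feasible set (in the control application, the set of dynamics- and actuator-feasible trajectories), $J:\mathbb R^d\to\mathbb R$ is the performance objective, and $g_{i,j}:\mathbb R^d\to\mathbb R$ ($1\le i\le L$, $1\le j\le m_i$) are constraint functions, level $i=1$ having the highest priority. Write $[a]_+=\max(0,a)$. For a fixed $p\in\{1,2\}$ the violation functionals are $V_i(z)=\sum_{j=1}^{m_i}[g_{i,j}(z)]_+^p$. Lexicographic cascade: $\mathcal F_0=\mathcal Z$, and for $i=1,\dots,L$, $V_i^\star=\min_{z\in\mathcal F_{i-1}}V_i(z)$, $\mathcal F_i=\{z\in\mathcal F_{i-1}:V_i(z)=V_i^\star\}$. The lexicographic optimum is $z^\star_{\mathrm{lex}}\in\arg\min_{z\in\mathcal F_L}J(z)$, with $J^\star=J(z^\star_{\mathrm{lex}})$ and image $p^\star=(V_1^\star,\dots,V_L^\star,J^\star)\in\mathbb R^{L+1}$. Weighted-sum problem: for $w\in\mathbb R_{++}^L=(0,\infty)^L$, $z^\star_{\mathrm{ws}}(w)\in\arg\min_{z\in\mathcal Z}J(z)+\sum_i w_iV_i(z)$. Upper image: $\overline{\mathcal P}=\mathrm{cl}\{(y,t)\in\mathbb R^{L}\times\mathbb R:\exists z\in\mathcal Z,\ V_i(z)\le y_i\ \forall i,\ J(z)\le t\}$. Outward normal cone (in the paper's sign convention): $N^+_{\overline{\mathcal P}}(p^\star)=\{\eta\in\mathbb R^{L+1}:\langle\eta,q-p^\star\rangle\ge0\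 \forall q\in\overline{\mathcal P}\}$. Normalized equivalence region: $\Omega(p^\star)=\{w\in\mathbb R_{++}^L:(w,1)\in N^+_{\overline{\mathcal P}}(p^\star)\}$. *)

theory Defs
  imports "HOL-Analysis.Analysis"
begin

(* Levels are the numbers 1, ..., L and constraints of level i are the numbers 1, ..., m i. *)

definition violation ::
    "nat \<Rightarrow> (nat \<Rightarrow> nat) \<Rightarrow> (nat \<Rightarrow> nat \<Rightarrow> 'a \<Rightarrow> real) \<Rightarrow> nat \<Rightarrow> 'a \<Rightarrow> real" where
  "violation p m g i z = (\<Sum>j = 1..m i. (max 0 (g i j z)) ^ p)"

abbreviation argmin_on :: "('a \<Rightarrow> real) \<Rightarrow> 'a set \<Rightarrow> 'a \<Rightarrow> bool" where
  "argmin_on f S z \<equiv> is_arg_min f (\<lambda>x. x \<in> S) z"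

(* The INF is the minimum whenever the minimum is attained. *)
primrec cascade :: "(nat \<Rightarrow> 'a \<Rightarrow> real) \<Rightarrow> 'a set \<Rightarrow> nat \<Rightarrow> 'a set" where
  "cascade V Z 0 = Z"
| "cascade V Z (Suc n) =
     {z \<in> cascade V Z n. V (Suc n) z = (INF x\<in>cascade V Z n. V (Suc n) x)}"

definition level_opt :: "(nat \<Rightarrow> 'a \<Rightarrow> real) \<Rightarrow> 'a set \<Rightarrow> nat \<Rightarrow> real" where
  "level_opt V Z i = (INF x\<in>cascade V Z (i - 1). V i x)"

(* R^L is real ^ 'l with L = CARD('l).  The coordinates are identified with the levels
   1, ..., L by their position in the linear order of 'l. *)
definition level :: "'l::{finite,linorder} \<Rightarrow> nat" where
  "level k = card {..k}"

definition positive_weights :: "(real ^ 'l) set" where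
  "positive_weights = {w. \<forall>k. 0 < w $ k}"

definition weighted_objective ::
    "(nat \<Rightarrow> 'a \<Rightarrow> real) \<Rightarrow> ('a \<Rightarrow> real) \<Rightarrow> real ^ 'l::{finite,linorder} \<Rightarrow> 'a \<Rightarrow> real" where
  "weighted_objective V J w z = J z + (\<Sum>k\<in>UNIV. w $ k * V (level k) z)"

definition upper_image ::
    "(nat \<Rightarrow> 'a \<Rightarrow> real) \<Rightarrow> ('a \<Rightarrow> real) \<Rightarrow> 'a set \<Rightarrow> ((real ^ 'l::{finite,linorder}) \<times> real) set" where
  "upper_image V J Z =
     closure {(y, t). \<exists>z\<in>Z. (\<forall>k. V (level k) z \<le> y $ k) \<and> J z \<le> t}"

definition lex_image ::
    "(nat \<Rightarrow> 'a \<Rightarrow> real) \<Rightarrow> ('a \<Rightarrow> real) \<Rightarrow> 'a set \<Rightarrow> 'a \<Rightarrow> (real ^ 'l::{finite,linorder}) \<times> real" where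
  "lex_image V J Z zlex = ((\<chi> k. level_opt V Z (level k)), J zlex)"

(* The sign is opposite to the usual normal cone of convex analysis. *)
definition normal_cone_plus :: "'b::real_inner set \<Rightarrow> 'b \<Rightarrow> 'b set" where
  "normal_cone_plus P p = {\<eta>. \<forall>q\<in>P. inner \<eta> (q - p) \<ge> 0}"

definition equivalence_region ::
    "((real ^ 'l) \<times> real) set \<Rightarrow> (real ^ 'l) \<times> real \<Rightarrow> (real ^ 'l) set" where
  "equivalence_region P p = {w \<in> positive_weights. (w, 1) \<in> normal_cone_plus P p}"

definition strictly_convex_on :: "'a::real_vector set \<Rightarrow> ('a \<Rightarrow> real) \<Rightarrow> bool" where
  "strictly_convex_on S f \<longleftrightarrow> convex S \<and>
     (\<forall>x\<in>S. \<forall>y\<in>S. \<forall>t. x \<noteq> y \<and> 0 < t \<and> t < 1 \<longrightarrow>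
        f ((1 - t) *\<^sub>R x + t *\<^sub>R y) < (1 - t) * f x + t * f y)"

end

theory Submission
  imports Defs
begin

text \<open>
  At a point (V z, J z), the pairing with (w, 1) is exactly the weighted-sum objective of z.
  Hence z minimizes that objective over Z iff the linear functional (w, 1) attains its minimum
  over the set of attained outcomes at the outcome of z. Adding the upward directions does not
  change that minimum since w is positive, and neither does taking the closure since half-spaces
  are closed; so the condition says that (w, 1) lies in the normal cone of the upper image
  (\<open>argmin_iff_normal_cone\<close>). This holds for every feasible z. It applies to the lexicographic
  optimum because membership in the last cascade set forces its violations to be the optimal
  values of all levels, so that the image p* is its outcome (\<open>lex_image_eq\<close>).

  Two minimizers of a strictly convex weighted objective are excluded because their midpoint
  would do better.
\<close>

lemma cascade_level_opt:
  assumes "z \<in> cascade V Z n"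
  shows "z \<in> Z" and "\<And>i. i \<in> {1..n} \<Longrightarrow> V i z = level_opt V Z i"
proof -
  have "z \<in> Z \<and> (\<forall>i\<in>{1..n}. V i z = level_opt V Z i)"
    using assms
  proof (induction n)
    case 0
    then show ?case by simp
  next
    case (Suc n)
    then show ?case by (auto simp: level_opt_def atLeastAtMostSuc_conv)
  qed
  then show "z \<in> Z" and "\<And>i. i \<in> {1..n} \<Longrightarrow> V i z = level_opt V Z i"
    by auto
qed

lemma level_range: "level (k :: 'l::{finite,linorder}) \<in> {1..CARD('l)}"
proof -
  have "card {..k} > 0"
    by (subst card_gt_0_iff) auto
  moreover have "card {..k} \<le> CARD('l)"
    by (rule card_mono) auto
  ultimately show ?thesis
    by (simp add: level_def)
qed

lemma lex_image_eq:
  assumes "z \<in> cascade V Z CARD('l::{finite,linorder})"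
  shows "(lex_image V J Z z :: (real ^ 'l::{finite,linorder}) \<times> real) = ((\<chi> k. V (level k) z), J z)"
  using cascade_level_opt(2)[OF assms level_range] by (simp add: lex_image_def)

lemma weighted_objective_eq_inner:
  "weighted_objective V J w z = inner (w, 1) ((\<chi> k. V (level k) z), J z)"
  by (simp add: weighted_objective_def inner_vec_def)

text \<open>
  Lower bounds for a positive functional pass from attained outcomes to the upper image: a
  functional with nonnegative coefficients can only grow along the added upward directions, and
  the half-space that expresses the bound is closed.
\<close>
lemma upper_image_lower_bound:
  fixes w :: "real ^ 'l::{finite,linorder}"
  assumes w: "w \<in> positive_weights"
    and bound: "\<And>z. z \<in> Z \<Longrightarrow> c \<le> weighted_objective V J w z"
    and q: "q \<in> upper_image V J Z"
  shows "c \<le> inner (w, 1) q"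
proof -
  let ?A = "{(y :: real ^ 'l::{finite,linorder}, t). \<exists>z\<in>Z. (\<forall>k. V (level k) z \<le> y $ k) \<and> J z \<le> t}"
  have "?A \<subseteq> {q. inner (w, 1) q \<ge> c}"
  proof clarsimp
    fix y :: "real ^ 'l::{finite,linorder}" and t z
    assume z: "z \<in> Z" and V: "\<forall>k. V (level k) z \<le> y $ k" and J: "J z \<le> t"
    have "(\<Sum>k\<in>UNIV. w $ k * V (level k) z) \<le> (\<Sum>k\<in>UNIV. w $ k * y $ k)"
      using w V by (intro sum_mono mult_left_mono) (auto simp: positive_weights_def less_imp_le)
    then show "c \<le> inner w y + t"
      using bound[OF z] J by (simp add: weighted_objective_def inner_vec_def)
  qed
  then have "closure ?A \<subseteq> {q. inner (w, 1) q \<ge> c}"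
    by (rule closure_minimal) (rule closed_halfspace_ge)
  then show ?thesis
    using q by (auto simp: upper_image_def)
qed

text \<open>
  Outcomes of feasible points lie in the upper image, which gives the backward direction; the
  forward direction is the previous bound with the optimal value as constant. Geometrically, the
  hyperplane with normal (w, 1) through the outcome of z supports the upper image.
\<close>
lemma argmin_iff_normal_cone:
  fixes w :: "real ^ 'l::{finite,linorder}"
  assumes w: "w \<in> positive_weights" and z: "z \<in> Z"
  shows "argmin_on (weighted_objective V J w) Z z \<longleftrightarrow>
    (w, 1) \<in> normal_cone_plus (upper_image V J Z) ((\<chi> k. V (level k) z), J z)"
    (is "_ \<longleftrightarrow> (w, 1) \<in> normal_cone_plus ?P ?o")
proof
  assume "argmin_on (weighted_objective V J w) Z z"
  then have "inner (w, 1) ?o \<le> inner (w, 1) q" if "q \<in> ?P" for q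
    using upper_image_lower_bound[OF w _ that]
    by (simp add: is_arg_min_linorder weighted_objective_eq_inner)
  then show "(w, 1) \<in> normal_cone_plus ?P ?o"
    by (simp add: normal_cone_plus_def inner_diff_right del: inner_Pair)
next
  assume cone: "(w, 1) \<in> normal_cone_plus ?P ?o"
  have "weighted_objective V J w z \<le> weighted_objective V J w x" if "x \<in> Z" for x
  proof -
    have "((\<chi> k. V (level k) x), J x) \<in> ?P"
      unfolding upper_image_def using that by (intro subsetD[OF closure_subset]) auto
    then show ?thesis
      using cone
      by (simp add: normal_cone_plus_def inner_diff_right weighted_objective_eq_inner
          del: inner_Pair diff_Pair)
  qed
  then show "argmin_on (weighted_objective V J w) Z z"
    using z by (simp add: is_arg_min_linorder)
qed

lemma strictly_convex_argmin_unique: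
  assumes f: "strictly_convex_on S f" and x: "argmin_on f S x" and y: "argmin_on f S y"
  shows "x = y"
proof (rule ccontr)
  assume "x \<noteq> y"
  define u where "u = (1 - 1/2) *\<^sub>R x + (1/2 :: real) *\<^sub>R y"
  have S: "x \<in> S" "y \<in> S"
    using x y by (auto simp: is_arg_min_linorder)
  have "f u < (1 - 1/2) * f x + 1/2 * f y"
    using f S \<open>x \<noteq> y\<close> unfolding strictly_convex_on_def u_def
    by (elim conjE ballE allE[of _ "1/2 :: real"]) auto
  moreover have "u \<in> S"
    unfolding u_def using f S by (intro convexD_alt) (auto simp: strictly_convex_on_def)
  then have "f x \<le> f u" "f y \<le> f u"
    using x y by (auto simp: is_arg_min_linorder)
  ultimately show False
    by simp
qed

theorem mainTheorem1:
  fixes Z :: "(real ^ 'd) set"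
    and J :: "real ^ 'd \<Rightarrow> real"
    and g :: "nat \<Rightarrow> nat \<Rightarrow> real ^ 'd \<Rightarrow> real"
    and m :: "nat \<Rightarrow> nat"
    and p L :: nat
    and V :: "nat \<Rightarrow> real ^ 'd \<Rightarrow> real"
    and zlex :: "real ^ 'd"
    and pstar :: "(real ^ 'l::{finite,linorder}) \<times> real"
    and \<Omega> :: "(real ^ 'l::{finite,linorder}) set"
  defines "L \<equiv> CARD('l)"
    and "V \<equiv> violation p m g"
    and "pstar \<equiv> lex_image V J Z zlex"
    and "\<Omega> \<equiv> equivalence_region (upper_image V J Z) pstar"
  assumes p: "p \<in> {1, 2}"
    and m: "\<And>i. i \<in> {1..L} \<Longrightarrow> m i \<ge> 1"
    and compact_Z: "compact Z"
    and cascade_attained: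
      "\<And>i. i \<in> {1..L} \<Longrightarrow> \<exists>z. argmin_on (V i) (cascade V Z (i - 1)) z"
    and lex_exists: "\<exists>z. argmin_on J (cascade V Z L) z"
    and ws_exists:
      "\<And>w :: real ^ 'l::{finite,linorder}. w \<in> positive_weights \<Longrightarrow> \<exists>z. argmin_on (weighted_objective V J w) Z z"
    and zlex: "argmin_on J (cascade V Z L) zlex"
    and zlex_unique: "\<And>z. argmin_on J (cascade V Z L) z \<Longrightarrow> z = zlex"
    and convex_Z: "convex Z"
    and convex_g: "\<And>i j. i \<in> {1..L} \<Longrightarrow> j \<in> {1..m i} \<Longrightarrow> convex_on UNIV (g i j)"
    and convex_J: "convex_on UNIV J"
  shows "(\<forall>w :: real ^ 'l::{finite,linorder} \<in> positive_weights. argmin_on (weighted_objective V J w) Z zlex \<longleftrightarrow> w \<in> \<Omega>)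
    \<and> (\<forall>w \<in> \<Omega>. (\<exists>!z. argmin_on (weighted_objective V J w) Z z) \<longrightarrow>
          (\<forall>zws. argmin_on (weighted_objective V J w) Z zws \<longrightarrow> zws = zlex))
    \<and> (\<forall>w :: real ^ 'l::{finite,linorder} \<in> positive_weights. strictly_convex_on Z (weighted_objective V J w) \<longrightarrow>
          (\<exists>!z. argmin_on (weighted_objective V J w) Z z))"
proof (intro conjI ballI impI allI)
  have lex: "zlex \<in> cascade V Z CARD('l)"
    using zlex by (simp add: is_arg_min_def L_def)
  have iff: "argmin_on (weighted_objective V J w) Z zlex \<longleftrightarrow> w \<in> \<Omega>"
    if "w \<in> positive_weights" for w :: "real ^ 'l::{finite,linorder}"
    using argmin_iff_normal_cone[OF that cascade_level_opt(1)[OF lex], of V J] that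
    by (simp add: \<Omega>_def pstar_def equivalence_region_def lex_image_eq[OF lex])
  show "argmin_on (weighted_objective V J w) Z zlex \<longleftrightarrow> w \<in> \<Omega>"
    if "w \<in> positive_weights" for w :: "real ^ 'l::{finite,linorder}"
    using that by (rule iff)
  show "zws = zlex"
    if "w \<in> \<Omega>" and "\<exists>!z. argmin_on (weighted_objective V J w) Z z"
      and "argmin_on (weighted_objective V J w) Z zws" for w zws
  proof -
    have "w \<in> positive_weights"
      using that(1) by (simp add: \<Omega>_def equivalence_region_def)
    then show ?thesis
      using iff that by blast
  qed
  show "\<exists>!z. argmin_on (weighted_objective V J w) Z z"
    if "w \<in> positive_weights" and "strictly_convex_on Z (weighted_objective V J w)"
    for w :: "real ^ 'l::{finite,linorder}"
    using ws_exists[OF that(1)] strictly_convex_argmin_unique[OF that(2)] by blast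
qed

end
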